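(* Let $\vartheta=(p,a,b)'\in\mathbb{R}\times(0,\infty)^2$, let $\vartheta^{(n)}\in\mathbb{R}\times(0,\infty)^2$ be any sequence with $\vartheta^{(n)}=\vartheta+O(n^{-1/2})$, and let $\tau^{(n)}=(\tau_1^{(n)},\tau_2^{(n)},\tau_3^{(n)})'\in\mathbb{R}^3$ be any bounded sequence such that $a+n^{-1/2}\tau_2^{(n)}>0$ and $b+n^{-1/2}\tau_3^{(n)}>0$. Then the central sequence $\Delta^{(n)}$ of the GIG model satisfies the asymptotic linearity property $$\Delta^{(n)}\left(\vartheta+n^{-1/2}\tau^{(n)}\right)=\Delta^{(n)}(\vartheta)-\Gamma(\vartheta)\tau^{(n)}+o_{\mathrm P}(1)$$ as $n\to\infty$, under $\mathrm{P}^{(n)}_{\vartheta^{(n)}}$.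
   Context: $\mathrm{GIG}(p,a,b)$ ($p\in\mathbb{R}$, $a,b>0$) has density $\frac{(a/b)^{p/2}}{2K_p(\sqrt{ab})}x^{p-1}e^{-(ax+b/x)/2}$, $x>0$, where $K_p(z)=\frac12\int_0^\infty t^{p-1}e^{-z(t+1/t)/2}dt$ is the modified Bessel function of the third kind. $\mathrm{P}^{(n)}_{\vartheta}=\mathrm{P}^{(n)}_{p,a,b}$ is the joint law of $n$ i.i.d. $\mathrm{GIG}(p,a,b)$ observations $X_1,\dots,X_n$. Partial derivatives below are those of $(p,a,b)\mapsto\log K_p(\sqrt{ab})$. Central sequence: $\Delta^{(n)}(\vartheta)=(\Delta^{(n)}_p(\vartheta),\Delta^{(n)}_a(\vartheta),\Delta^{(n)}_b(\vartheta))'$ with $\Delta^{(n)}_p(\vartheta)=n^{-1/2}\sum_{i=1}^n\left(\frac12\log(a/b)-\partial_p\log K_p(\sqrt{ab})+\log X_i\right)$, $\Delta^{(n)}_a(\vartheta)=n^{-1/2}\sum_{i=1}^n\left(\frac p{2a}-\partial_a\log K_p(\sqrt{ab})-\frac{X_i}2\right)$, $\Delta^{(n)}_b(\vartheta)=n^{-1/2}\sum_{i=1}^n\left(-\frac p{2b}-\partial_b\log K_p(\sqrt{ab})-\frac1{2X_i}\right)$. Fisher information matrix $\Gamma(\vartheta)$ (symmetric, rows and columns indexed by $p,a,b$): $\Gamma_{p,p}=\partial^2_{pp}\log K_p(\sqrt{ab})$, $\Gamma_{a,a}=\frac p{2a^2}+\partial^2_{aa}\log K_p(\sqrt{ab})$,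 $\Gamma_{b,b}=-\frac p{2b^2}+\partial^2_{bb}\log K_p(\sqrt{ab})$, $\Gamma_{p,a}=-\frac1{2a}+\partial^2_{ap}\log K_p(\sqrt{ab})$, $\Gamma_{p,b}=\frac1{2b}+\partial^2_{bp}\log K_p(\sqrt{ab})$, $\Gamma_{a,b}=\partial^2_{ab}\log K_p(\sqrt{ab})$. *)

theory Defs
  imports "HOL-Probability.Probability" "HOL-Library.Landau_Symbols"
begin

(* A parameter (p, a, b) is a vector in real^3 with components $ 1, $ 2, $ 3. *)
definition gig_params :: "(real ^ 3) set" where
  "gig_params = {\<theta>. 0 < \<theta> $ 2 \<and> 0 < \<theta> $ 3}"

definition bessel_K :: "real \<Rightarrow> real \<Rightarrow> real" where
  "bessel_K p z =
     1 / 2 * (LINT t:{0<..}|lborel. t powr (p - 1) * exp (- z * (t + 1 / t) / 2))"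

definition gig_density :: "real \<Rightarrow> real \<Rightarrow> real \<Rightarrow> real \<Rightarrow> real" where
  "gig_density p a b x =
     (if 0 < x
      then (a / b) powr (p / 2) / (2 * bessel_K p (sqrt (a * b)))
             * x powr (p - 1) * exp (- (a * x + b / x) / 2)
      else 0)"

definition GIG :: "real \<Rightarrow> real \<Rightarrow> real \<Rightarrow> real measure" where
  "GIG p a b = density lborel (\<lambda>x. ennreal (gig_density p a b x))"

(* The observations X_1, ..., X_n are the coordinate maps on the product space. *)
definition gig_law :: "nat \<Rightarrow> real ^ 3 \<Rightarrow> (nat \<Rightarrow> real) measure" where
  "gig_law n \<theta> = PiM {1..n} (\<lambda>_. GIG (\<theta> $ 1) (\<theta> $ 2) (\<theta> $ 3))"

definition log_K :: "real \<Rightarrow> real \<Rightarrow> real \<Rightarrow> real" where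
  "log_K p a b = ln (bessel_K p (sqrt (a * b)))"

definition partial_p :: "(real \<Rightarrow> real \<Rightarrow> real \<Rightarrow> real) \<Rightarrow> real \<Rightarrow> real \<Rightarrow> real \<Rightarrow> real" where
  "partial_p f p a b = deriv (\<lambda>p'. f p' a b) p"

definition partial_a :: "(real \<Rightarrow> real \<Rightarrow> real \<Rightarrow> real) \<Rightarrow> real \<Rightarrow> real \<Rightarrow> real \<Rightarrow> real" where
  "partial_a f p a b = deriv (\<lambda>a'. f p a' b) a"

definition partial_b :: "(real \<Rightarrow> real \<Rightarrow> real \<Rightarrow> real) \<Rightarrow> real \<Rightarrow> real \<Rightarrow> real \<Rightarrow> real" where
  "partial_b f p a b = deriv (\<lambda>b'. f p a b') b"

definition central_sequence :: "nat \<Rightarrow> real ^ 3 \<Rightarrow> (nat \<Rightarrow> real) \<Rightarrow> real ^ 3" where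
  "central_sequence n \<theta> X =
     (let p = \<theta> $ 1; a = \<theta> $ 2; b = \<theta> $ 3 in
      vector
       [real n powr (- 1 / 2) * (\<Sum>i=1..n. ln (a / b) / 2 - partial_p log_K p a b + ln (X i)),
        real n powr (- 1 / 2) * (\<Sum>i=1..n. p / (2 * a) - partial_a log_K p a b - X i / 2),
        real n powr (- 1 / 2) * (\<Sum>i=1..n. - p / (2 * b) - partial_b log_K p a b - 1 / (2 * X i))])"

definition fisher_information :: "real ^ 3 \<Rightarrow> real ^ 3 ^ 3" where
  "fisher_information \<theta> =
     (let p = \<theta> $ 1; a = \<theta> $ 2; b = \<theta> $ 3;
          \<Gamma>pp = partial_p (partial_p log_K) p a b;
          \<Gamma>aa = p / (2 * a\<^sup>2) + partial_a (partial_a log_K) p a b;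
          \<Gamma>bb = - p / (2 * b\<^sup>2) + partial_b (partial_b log_K) p a b;
          \<Gamma>pa = - 1 / (2 * a) + partial_a (partial_p log_K) p a b;
          \<Gamma>pb = 1 / (2 * b) + partial_b (partial_p log_K) p a b;
          \<Gamma>ab = partial_a (partial_b log_K) p a b
      in vector [vector [\<Gamma>pp, \<Gamma>pa, \<Gamma>pb],
                 vector [\<Gamma>pa, \<Gamma>aa, \<Gamma>ab],
                 vector [\<Gamma>pb, \<Gamma>ab, \<Gamma>bb]])"

(* Y n = o_P(1) under the n-th law M n.  Measurability is demanded because
   measure assigns 0 to non-measurable sets. *)
definition small_o_P :: "(nat \<Rightarrow> 'a measure) \<Rightarrow> (nat \<Rightarrow> 'a \<Rightarrow> 'b::euclidean_space) \<Rightarrow> bool" where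
  "small_o_P M Y \<longleftrightarrow>
     (\<forall>n. Y n \<in> borel_measurable (M n)) \<and>
     (\<forall>\<epsilon>>0. (\<lambda>n. measure (M n) {\<omega> \<in> space (M n). \<epsilon> < norm (Y n \<omega>)}) \<longlonglongrightarrow> 0)"

end

theory Submission
  imports Defs
begin

text \<open>The data enter the central sequence through \<open>ln X\<close>, \<open>X\<close> and \<open>1 / X\<close> with coefficients that do
  not depend on the parameter, so they cancel in the difference and the remainder is deterministic.
  What is left is the total differentiability of the parameter-dependent part of the score, with
  Jacobian minus the Fisher information. With \<open>u = (t + 1 / t) / 2\<close>, the integrals of
  \<open>(ln t) ^ j * u ^ k * t powr (p - 1) * exp (- z * u)\<close> are jointly differentiable in \<open>(p, z)\<close> and
  closed under differentiation: as \<open>\<bar>ln t\<bar> \<le> 2 * u\<close>, the remainder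
  \<open>exp x - 1 - x\<close> with \<open>x = d * ln t - e * u\<close> is \<open>O((\<bar>d\<bar> + \<bar>e\<bar>)\<^sup>2)\<close> times an integrable function.\<close>

section \<open>Moment integrals of the Bessel weight: domination, integrability, positivity\<close>

text \<open>For \<open>z > 0\<close> this is twice the Bessel function, differentiated
  \<open>j\<close> times in \<open>p\<close> and \<open>k\<close> times in \<open>-z\<close>: each
  \<open>p\<close>-derivative brings down \<open>ln t\<close>, each \<open>z\<close>-derivative
  brings down minus \<open>(t + 1 / t) / 2\<close>.\<close>

definition K_mom :: "nat \<Rightarrow> nat \<Rightarrow> real \<Rightarrow> real \<Rightarrow> real" where
  "K_mom j k p z = (LINT t:{0<..}|lborel.
     ln t ^ j * ((t + 1 / t) / 2) ^ k * t powr (p - 1) * exp (- z * ((t + 1 / t) / 2)))"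

lemma abs_ln_le_add_inverse:
  fixes t :: real
  assumes "0 < t"
  shows "\<bar>ln t\<bar> \<le> t + 1 / t"
proof -
  have "ln t \<le> t - 1" "ln (1 / t) \<le> 1 / t - 1"
    using assms by (intro ln_le_minus_one; simp)+
  moreover have "ln (1 / t) = - ln t" "0 < 1 / t"
    using assms by (simp_all add: ln_div)
  ultimately show ?thesis
    using assms by linarith
qed

lemma abs_exp_remainder_le:
  fixes x :: real
  shows "\<bar>exp x - 1 - x\<bar> \<le> x\<^sup>2 * exp \<bar>x\<bar> / 2"
proof -
  obtain t where t: "\<bar>t\<bar> \<le> \<bar>x\<bar>"
    "exp x = (\<Sum>m<2. x ^ m / fact m) + exp t / fact 2 * x ^ 2"
    using Maclaurin_exp_le[of x 2] by blast
  have eq: "exp x - 1 - x = exp t * x\<^sup>2 / 2"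
    using t(2) by (simp add: numeral_2_eq_2)
  have "exp t \<le> exp \<bar>x\<bar>"
    using t(1) by simp
  then have "exp t * x\<^sup>2 \<le> exp \<bar>x\<bar> * x\<^sup>2"
    by (intro mult_right_mono) auto
  then show ?thesis
    unfolding eq by (simp add: abs_mult mult.commute)
qed

lemma power_le_fact_exp:
  fixes x :: real
  assumes "0 \<le> x"
  shows "x ^ n \<le> fact n * exp x"
proof -
  have "x ^ n / fact n \<le> exp x"
    using sum_le_suminf[of "\<lambda>n. x ^ n / fact n" "{n}"] assms summable_exp[of x]
    by (simp add: exp_def divide_inverse mult.commute scaleR_conv_of_real)
  then show ?thesis
    by (simp add: field_simps)
qed

lemma set_integrable_exp_neg:
  fixes c :: real
  assumes "0 < c"
  shows "set_integrable lborel {0<..} (\<lambda>t. exp (- c * t))"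
proof -
  have "(\<lambda>t. exp (- c * t)) absolutely_integrable_on {0..}"
    using assms
    using integrable_on_exp_minus_to_infinity[of c 0]
    by (intro nonnegative_absolutely_integrable_1) auto
  then have "set_integrable lebesgue {0<..} (\<lambda>t. exp (- c * t))"
    by (rule set_integrable_subset) auto
  then show ?thesis
    unfolding set_integrable_def by (subst (asm) integrable_completion) auto
qed

text \<open>The quantity \<open>s = t + 1 / t\<close> dominates \<open>t\<close>,
  \<open>1 / t\<close>, \<open>\<bar>ln t\<bar>\<close> and 1, so it controls the ends 0 and
  infinity at once. All factors but the exponential are at most a power of \<open>s\<close>, and
  half of the decay \<open>exp (- c * s / 2)\<close> absorbs that power.\<close>

lemma bessel_integrand_bound:
  fixes c p :: real
  assumes c: "0 < c"
  obtains C where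
    "\<And>t. 0 < t \<Longrightarrow>
      \<bar>ln t ^ j * ((t + 1 / t) / 2) ^ k * t powr (p - 1) * exp (- c * ((t + 1 / t) / 2))\<bar>
        \<le> C * exp (- (c / 4) * t)"
proof
  \<comment> \<open>Rounding the exponent up gives a natural power of \<open>s\<close>, which a
    single term of the exponential series can bound.\<close>
  define N where "N = nat \<lceil>\<bar>p - 1\<bar>\<rceil>"
  define M where "M = j + k + N"
  fix t :: real assume t: "0 < t"
  define s where "s = t + 1 / t"
  have s: "t \<le> s" "1 / t \<le> s" "0 < s" "1 \<le> s"
  proof -
    show "t \<le> s" "1 / t \<le> s" "0 < s" using t by (auto simp: s_def add_pos_pos)
    show "1 \<le> s"
    proof (cases "1 \<le> t")
      case False
      then have "1 \<le> 1 / t" using t by (simp add: field_simps)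
      then show ?thesis using t unfolding s_def by linarith
    qed (use t in \<open>auto simp: s_def intro: add_increasing2\<close>)
  qed
  have "t powr (p - 1) \<le> s powr \<bar>p - 1\<bar>"
  proof (cases "1 \<le> p")
    case True
    then show ?thesis using t s by (simp add: powr_mono2)
  next
    case False
    \<comment> \<open>A negative exponent is moved to \<open>1 / t\<close>, which is also at most
      \<open>s\<close>.\<close>
    have "t powr (p - 1) = (1 / t) powr (1 - p)"
      using t by (simp add: powr_divide powr_minus[symmetric] powr_diff)
    then show ?thesis using False t s powr_mono2[of "1 - p" "1 / t" s] by simp
  qed
  also have "\<dots> \<le> s powr real N"
    using s by (intro powr_mono) (auto simp: N_def)
  also have "\<dots> = s ^ N"
    using s by (simp add: powr_realpow)
  finally have powr: "t powr (p - 1) \<le> s ^ N" .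
  have ln: "\<bar>ln t\<bar> ^ j \<le> s ^ j"
    using abs_ln_le_add_inverse[OF t] by (intro power_mono) (auto simp: s_def)
  have "(c / 4 * s) ^ M \<le> fact M * exp (c / 4 * s)"
    using c s by (intro power_le_fact_exp) auto
  then have "(c / 4) ^ M * s ^ M \<le> fact M * exp (c / 4 * s)"
    by (simp only: power_mult_distrib)
  then have sM: "s ^ M \<le> fact M / (c / 4) ^ M * exp (c / 4 * s)"
    using c by (simp add: field_simps)
  have "\<bar>ln t ^ j * ((t + 1 / t) / 2) ^ k * t powr (p - 1) * exp (- c * ((t + 1 / t) / 2))\<bar>
    = \<bar>ln t\<bar> ^ j * (s / 2) ^ k * t powr (p - 1) * exp (- c * (s / 2))"
    using s by (simp add: abs_mult power_abs s_def[symmetric])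
  also have "\<dots> \<le> s ^ j * s ^ k * s ^ N * exp (- c * (s / 2))"
    using s ln powr by (intro mult_mono power_mono[of "s / 2" s k] order_refl) auto
  also have "\<dots> = s ^ M * exp (- c * (s / 2))"
    by (simp add: M_def power_add)
  also have "\<dots> \<le> fact M / (c / 4) ^ M * exp (c / 4 * s) * exp (- c * (s / 2))"
    using sM by (intro mult_right_mono) auto
  also have "\<dots> = fact M / (c / 4) ^ M * exp (- (c / 4) * s)"
    by (simp add: exp_add[symmetric])
  also have "\<dots> \<le> fact M / (c / 4) ^ M * exp (- (c / 4) * t)"
    using c s by (intro mult_left_mono) auto
  finally show "\<bar>ln t ^ j * ((t + 1 / t) / 2) ^ k * t powr (p - 1) * exp (- c * ((t + 1 / t) / 2))\<bar>
        \<le> fact M / (c / 4) ^ M * exp (- (c / 4) * t)" .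
qed

lemma set_integrable_bessel_integrand:
  fixes c p :: real
  assumes c: "0 < c"
  shows "set_integrable lborel {0<..}
    (\<lambda>t. ln t ^ j * ((t + 1 / t) / 2) ^ k * t powr (p - 1) * exp (- c * ((t + 1 / t) / 2)))"
    (is "set_integrable _ _ ?f")
proof -
  obtain C where C: "\<And>t. 0 < t \<Longrightarrow> \<bar>?f t\<bar> \<le> C * exp (- (c / 4) * t)"
    using bessel_integrand_bound[OF c] by blast
  have "set_integrable lborel {0<..} (\<lambda>t. C * exp (- (c / 4) * t))"
    using c set_integrable_exp_neg[of "c / 4"] by (intro set_integrable_mult_right) auto
  then show ?thesis
    by (rule set_integrable_bound)
       (use C in \<open>auto simp: set_borel_measurable_def intro!: AE_I2 order_trans[OF _ abs_ge_self]\<close>)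
qed

text \<open>A zero integral would make the nonnegative integrand vanish almost everywhere; it is
  strictly positive on (0, 1), which is not a null set. Positivity permits logarithms of and
  division by this moment later.\<close>

lemma K_mom_0_pos:
  assumes "0 < z"
  shows "0 < K_mom 0 0 p z"
proof -
  let ?f = "\<lambda>t::real. t powr (p - 1) * exp (- z * ((t + 1 / t) / 2))"
  have int: "set_integrable lborel {0<..} ?f"
    using set_integrable_bessel_integrand[OF assms, of 0 0 p] by simp
  have nonneg: "0 \<le> K_mom 0 0 p z"
    unfolding K_mom_def set_lebesgue_integral_def
    by (intro integral_nonneg_AE) (auto simp: indicator_def)
  have "K_mom 0 0 p z \<noteq> 0"
  proof
    assume "K_mom 0 0 p z = 0"
    then have "AE t in lborel. indicator {0<..} t *\<^sub>R ?f t = 0"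
      using int unfolding K_mom_def set_lebesgue_integral_def set_integrable_def
      by (subst (asm) integral_nonneg_eq_0_iff_AE) (auto simp: indicator_def)
    then have "AE t in lborel. t \<notin> {0<..<1::real}"
      by eventually_elim (auto simp: indicator_def)
    then have "emeasure lborel {0<..<1::real} = 0"
      by (subst (asm) AE_iff_measurable[where N = "{0<..<1}"]) auto
    then show False by (simp add: emeasure_lborel_Ioo del: greaterThanLessThan_iff)
  qed
  with nonneg show ?thesis by simp
qed

lemma bessel_K_eq_K_mom: "bessel_K p z = K_mom 0 0 p z / 2"
  by (simp add: bessel_K_def K_mom_def)

section \<open>Joint differentiability of the moments in \<open>(p, z)\<close>\<close>

text \<open>Shifting \<open>(p, z)\<close> by \<open>(d, e)\<close> multiplies the integrand by
  \<open>exp x\<close>. The restriction to \<open>z / 4\<close> makes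
  \<open>exp \<bar>x\<bar>\<close> cost at most half of the decay in \<open>z\<close>, so one
  integrable function, with \<open>z / 2\<close> in place of \<open>z\<close> and two more factors
  \<open>u\<close>, serves all \<open>d\<close> and \<open>e\<close>.\<close>

lemma K_mom_taylor:
  assumes z: "0 < z"
  obtains C where
    "\<And>d e. \<bar>d\<bar> + \<bar>e\<bar> \<le> z / 4 \<Longrightarrow>
       \<bar>K_mom j k (p + d) (z + e) - K_mom j k p z
          - (d * K_mom (Suc j) k p z - e * K_mom j (Suc k) p z)\<bar>
       \<le> C * (\<bar>d\<bar> + \<bar>e\<bar>)\<^sup>2"
proof
  define f where "f j k p z t =
    ln t ^ j * ((t + 1 / t) / 2) ^ k * t powr (p - 1) * exp (- z * ((t + 1 / t) / 2))"
    for j k :: nat and p z t :: real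
  have K: "K_mom j k p z = (LINT t:{0<..}|lborel. f j k p z t)" for j k p z
    by (simp add: K_mom_def f_def)
  have int: "set_integrable lborel {0<..} (f j k p z)" if "0 < z" for j k p z
    using set_integrable_bessel_integrand[OF that, of j k p]
    by (simp add: f_def[abs_def])
  fix d e :: real
  define r where "r = \<bar>d\<bar> + \<bar>e\<bar>"
  assume de: "\<bar>d\<bar> + \<bar>e\<bar> \<le> z / 4"
  then have r: "0 \<le> r" "r \<le> z / 4" "\<bar>e\<bar> \<le> r" "\<bar>d\<bar> \<le> r"
    by (auto simp: r_def)
  have ze: "0 < z + e"
    using r z by linarith
  define g where "g t = f j k (p + d) (z + e) t - f j k p z t
      - (d * f (Suc j) k p z t - e * f j (Suc k) p z t)" for t
  note ints = int[OF z] int[OF ze]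
  have g_int: "set_integrable lborel {0<..} g"
    unfolding g_def[abs_def] by (intro set_integral_diff(1) set_integrable_mult_right ints)
  have g_eq: "K_mom j k (p + d) (z + e) - K_mom j k p z
          - (d * K_mom (Suc j) k p z - e * K_mom j (Suc k) p z) = (LINT t:{0<..}|lborel. g t)"
    unfolding g_def K
    by (subst set_integral_diff(2), (intro set_integral_diff(1) set_integrable_mult_right ints)+)+
       simp
  have bound: "\<bar>g t\<bar> \<le> 2 * r\<^sup>2 * \<bar>f j (k + 2) p (z / 2) t\<bar>" if t: "0 < t" for t
  proof -
    define u where "u = (t + 1 / t) / 2"
    define x where "x = d * ln t - e * u"
    have u: "0 < u" using t by (simp add: u_def add_pos_pos)
    have lnu: "\<bar>ln t\<bar> \<le> 2 * u"
      using abs_ln_le_add_inverse[OF t] by (simp add: u_def)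
    have "\<bar>x\<bar> \<le> \<bar>d\<bar> * \<bar>ln t\<bar> + \<bar>e\<bar> * u"
      unfolding x_def using u abs_triangle_ineq4[of "d * ln t" "e * u"] by (simp add: abs_mult)
    \<comment> \<open>The second term is enlarged from \<open>u\<close> to \<open>2 * u\<close> so
      that \<open>r\<close> factors out.\<close>
    also have "\<dots> \<le> \<bar>d\<bar> * (2 * u) + \<bar>e\<bar> * (2 * u)"
      using lnu u by (intro add_mono mult_left_mono) auto
    also have "\<dots> = r * (2 * u)"
      by (simp add: r_def algebra_simps)
    finally have x: "\<bar>x\<bar> \<le> r * (2 * u)" .
    also have "\<dots> \<le> z / 4 * (2 * u)"
      using r u by (intro mult_right_mono) auto
    finally have xz: "\<bar>x\<bar> \<le> z / 2 * u" by (simp add: mult.commute)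
    have x2: "x\<^sup>2 \<le> (r * (2 * u))\<^sup>2"
      using x by (metis abs_ge_zero power2_abs power_mono)
    have "t powr (p + d - 1) = t powr (p - 1) * exp (d * ln t)"
      using t powr_add[of t "p - 1" d] by (simp add: powr_def[of t d] algebra_simps)
    moreover have "exp (- (z + e) * u) = exp (- z * u) * exp (- (e * u))" "exp x = exp (d * ln t) * exp (- (e * u))"
      by (simp_all only: x_def exp_add[symmetric]) (simp_all add: algebra_simps)
    ultimately have "f j k (p + d) (z + e) t = f j k p z t * exp x"
      by (simp only: f_def u_def[symmetric] mult_ac)
    then have "g t = f j k p z t * (exp x - 1 - x)"
      unfolding g_def by (simp only:) (simp add: f_def u_def[symmetric] x_def ring_distribs mult_ac)
    then have "\<bar>g t\<bar> = \<bar>f j k p z t\<bar> * \<bar>exp x - 1 - x\<bar>"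
      by (simp add: abs_mult)
    also have "\<dots> \<le> \<bar>f j k p z t\<bar> * (x\<^sup>2 * exp \<bar>x\<bar> / 2)"
      by (intro mult_left_mono abs_exp_remainder_le) auto
    also have "\<dots> \<le> \<bar>f j k p z t\<bar> * ((r * (2 * u))\<^sup>2 * exp (z / 2 * u) / 2)"
      using x2 xz by (intro mult_left_mono divide_right_mono mult_mono) auto
    \<comment> \<open>Squaring \<open>2 * u\<close> and halving leaves \<open>2 * u ^ 2\<close>: the
      2 goes into the constant and \<open>u ^ 2\<close> raises \<open>k\<close> to
      \<open>k + 2\<close>.\<close>
    also have "\<dots> = 2 * r\<^sup>2 * \<bar>f j (k + 2) p (z / 2) t\<bar>"
    proof -
      have "exp (- (z * u)) * exp (z / 2 * u) = exp (- (z / 2) * u)"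
        by (simp add: exp_add[symmetric])
      then show ?thesis
        using u by (simp add: f_def u_def[symmetric] abs_mult power2_eq_square)
    qed
    finally show ?thesis .
  qed
  have f2: "set_integrable lborel {0<..} (\<lambda>t. \<bar>f j (k + 2) p (z / 2) t\<bar>)"
    using int[of "z / 2"] z by (intro set_integrable_abs) auto
  have "\<bar>LINT t:{0<..}|lborel. g t\<bar> \<le> (LINT t:{0<..}|lborel. \<bar>g t\<bar>)"
    using set_integral_norm_bound[OF g_int] by simp
  also have "\<dots> \<le> (LINT t:{0<..}|lborel. 2 * r\<^sup>2 * \<bar>f j (k + 2) p (z / 2) t\<bar>)"
    using bound by (intro set_integral_mono set_integrable_abs g_int set_integrable_mult_right f2) auto
  finally show "\<bar>K_mom j k (p + d) (z + e) - K_mom j k p z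
          - (d * K_mom (Suc j) k p z - e * K_mom j (Suc k) p z)\<bar>
       \<le> (2 * (LINT t:{0<..}|lborel. \<bar>
          ln t ^ j * ((t + 1 / t) / 2) ^ (k + 2) * t powr (p - 1) * exp (- (z / 2) * ((t + 1 / t) / 2))\<bar>))
          * (\<bar>d\<bar> + \<bar>e\<bar>)\<^sup>2"
    unfolding g_eq f_def by (simp add: r_def mult_ac)
qed

lemma K_mom_has_derivative_pair:
  assumes z: "0 < z"
  shows "((\<lambda>x. K_mom j k (fst x) (snd x)) has_derivative
    (\<lambda>h. fst h * K_mom (Suc j) k p z - snd h * K_mom j (Suc k) p z)) (at (p, z))"
proof -
  obtain C where C: "\<And>d e. \<bar>d\<bar> + \<bar>e\<bar> \<le> z / 4 \<Longrightarrow>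
       \<bar>K_mom j k (p + d) (z + e) - K_mom j k p z
          - (d * K_mom (Suc j) k p z - e * K_mom j (Suc k) p z)\<bar>
       \<le> C * (\<bar>d\<bar> + \<bar>e\<bar>)\<^sup>2"
    using K_mom_taylor[OF z] by blast
  let ?R = "\<lambda>h. norm (K_mom j k (fst ((p, z) + h)) (snd ((p, z) + h)) - K_mom j k (fst (p, z)) (snd (p, z))
      - (fst h * K_mom (Suc j) k p z - snd h * K_mom j (Suc k) p z)) / norm h"
  have "(?R \<longlongrightarrow> 0) (at 0)"
  proof (rule tendsto_0_le[where K = 1])
    have "((\<lambda>h::real \<times> real. 4 * \<bar>C\<bar> * norm h) \<longlongrightarrow> 4 * \<bar>C\<bar> * norm (0::real \<times> real)) (at 0)"
      by (intro tendsto_intros)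
    then show "((\<lambda>h::real \<times> real. 4 * \<bar>C\<bar> * norm h) \<longlongrightarrow> 0) (at 0)" by simp
    \<comment> \<open>Each component of \<open>h\<close> is at most \<open>norm h\<close>, so radius
      \<open>z / 8\<close> keeps their sum within the \<open>z / 4\<close> of the Taylor
      bound.\<close>
    have "\<forall>\<^sub>F h in at (0::real \<times> real). norm h < z / 8"
      using z by (auto simp: eventually_at intro!: exI[of _ "z / 8"])
    then show "\<forall>\<^sub>F h in at 0. norm (?R h) \<le> norm (4 * \<bar>C\<bar> * norm h) * 1"
    proof eventually_elim
      case (elim h)
      obtain d e where h: "h = (d, e)" by (cases h)
      have de: "\<bar>d\<bar> \<le> norm h" "\<bar>e\<bar> \<le> norm h"
        using norm_fst_le[of d e] norm_snd_le[of e d] by (auto simp: h)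
      have "\<bar>K_mom j k (p + d) (z + e) - K_mom j k p z
          - (d * K_mom (Suc j) k p z - e * K_mom j (Suc k) p z)\<bar> \<le> C * (\<bar>d\<bar> + \<bar>e\<bar>)\<^sup>2"
        using de elim by (intro C) auto
      also have "\<dots> \<le> \<bar>C\<bar> * (2 * norm h)\<^sup>2"
        using de by (intro mult_mono power_mono) auto
      also have "\<dots> = 4 * \<bar>C\<bar> * norm h * norm h"
        by (simp add: power2_eq_square)
      finally show ?case
        by (cases "h = 0") (auto simp: h divide_le_eq)
    qed
  qed
  then show ?thesis
    unfolding has_derivative_at
    by (auto intro!: bounded_linear_intros bounded_linear_sub)
qed

lemma has_derivative_K_mom [derivative_intros]:
  assumes "(f has_derivative f') (at x)" "(g has_derivative g') (at x)" "0 < g x"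
  shows "((\<lambda>x. K_mom j k (f x) (g x)) has_derivative
    (\<lambda>h. f' h * K_mom (Suc j) k (f x) (g x) - g' h * K_mom j (Suc k) (f x) (g x))) (at x)"
  using has_derivative_compose[OF has_derivative_Pair[OF assms(1,2)]
      K_mom_has_derivative_pair[OF assms(3), of j k "f x"]] by simp

section \<open>From total derivatives to partial derivatives\<close>

lemma has_derivative_vec_nth_at [derivative_intros]:
  "((\<lambda>v. v $ i) has_derivative (\<lambda>h. h $ i)) (at (v :: real ^ 'n))"
  by (intro bounded_linear_imp_has_derivative bounded_linear_vec_nth)

text \<open>The formulas for first partials hold only on this set; openness lets them be
  differentiated once more at each of its points.\<close>

lemma open_gig_params: "open gig_params"
  unfolding gig_params_def
  by (intro open_Collect_conj open_Collect_less continuous_on_component continuous_on_const continuous_on_id)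

lemma
  fixes f :: "real \<Rightarrow> real \<Rightarrow> real \<Rightarrow> real"
  assumes f: "((\<lambda>v. f (v $ 1) (v $ 2) (v $ 3)) has_derivative
    (\<lambda>h. h $ 1 * A + h $ 2 * B + h $ 3 * C)) (at (\<theta> :: real ^ 3))"
  shows partial_p_eq: "partial_p f (\<theta> $ 1) (\<theta> $ 2) (\<theta> $ 3) = A"
    and partial_a_eq: "partial_a f (\<theta> $ 1) (\<theta> $ 2) (\<theta> $ 3) = B"
    and partial_b_eq: "partial_b f (\<theta> $ 1) (\<theta> $ 2) (\<theta> $ 3) = C"
proof -
  \<comment> \<open>The coordinate line is parametrised so that its \<open>i\<close>-th component is
    \<open>t\<close> itself and the others stay fixed; the composite is then literally the function
    under \<open>deriv\<close>.\<close>
  have line: "((\<lambda>t. f ((\<theta> + (t - \<theta> $ i) *\<^sub>R axis i 1) $ 1) ((\<theta> + (t - \<theta> $ i) *\<^sub>R axis i 1) $ 2)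
      ((\<theta> + (t - \<theta> $ i) *\<^sub>R axis i 1) $ 3)) has_real_derivative
    axis i 1 $ 1 * A + axis i 1 $ 2 * B + axis i 1 $ 3 * C) (at (\<theta> $ i))" for i :: 3
  proof -
    have "((\<lambda>t. \<theta> + (t - \<theta> $ i) *\<^sub>R axis i 1) has_derivative (\<lambda>t. t *\<^sub>R axis i 1)) (at (\<theta> $ i))"
      by (auto intro!: derivative_eq_intros)
    from has_derivative_compose[OF this, of "\<lambda>v. f (v $ 1) (v $ 2) (v $ 3)"
        "\<lambda>h. h $ 1 * A + h $ 2 * B + h $ 3 * C"] f
    have "((\<lambda>t. f ((\<theta> + (t - \<theta> $ i) *\<^sub>R axis i 1) $ 1) ((\<theta> + (t - \<theta> $ i) *\<^sub>R axis i 1) $ 2)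
        ((\<theta> + (t - \<theta> $ i) *\<^sub>R axis i 1) $ 3)) has_derivative
      (\<lambda>t. (t *\<^sub>R axis i 1) $ 1 * A + (t *\<^sub>R axis i 1) $ 2 * B + (t *\<^sub>R axis i 1) $ 3 * C)) (at (\<theta> $ i))"
      by simp
    then show ?thesis
      unfolding has_field_derivative_def
      by (rule has_derivative_eq_rhs) (simp add: fun_eq_iff distrib_left distrib_right mult.assoc)
  qed
  show "partial_p f (\<theta> $ 1) (\<theta> $ 2) (\<theta> $ 3) = A"
    unfolding partial_p_def using line[of 1] by (intro DERIV_imp_deriv) (simp add: axis_def)
  show "partial_a f (\<theta> $ 1) (\<theta> $ 2) (\<theta> $ 3) = B"
    unfolding partial_a_def using line[of 2] by (intro DERIV_imp_deriv) (simp add: axis_def)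
  show "partial_b f (\<theta> $ 1) (\<theta> $ 2) (\<theta> $ 3) = C"
    unfolding partial_b_def using line[of 3] by (intro DERIV_imp_deriv) (simp add: axis_def)
qed

section \<open>First and second derivatives of the log Bessel function\<close>

definition K_ratio_p :: "real ^ 3 \<Rightarrow> real" where
  "K_ratio_p v = K_mom 1 0 (v $ 1) (sqrt (v $ 2 * v $ 3)) / K_mom 0 0 (v $ 1) (sqrt (v $ 2 * v $ 3))"

text \<open>With \<open>z = sqrt (a * b)\<close> this is minus the \<open>z\<close>-derivative of
  the log Bessel function, divided by \<open>2 * z\<close>. As \<open>z\<close> has partials
  \<open>b / (2 * z)\<close> and \<open>a / (2 * z)\<close>, this one function yields both
  \<open>partial_a log_K\<close> and \<open>partial_b log_K\<close>.\<close>

definition K_ratio_z :: "real ^ 3 \<Rightarrow> real" where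
  "K_ratio_z v = K_mom 0 1 (v $ 1) (sqrt (v $ 2 * v $ 3)) /
     (2 * sqrt (v $ 2 * v $ 3) * K_mom 0 0 (v $ 1) (sqrt (v $ 2 * v $ 3)))"

lemma has_derivative_sqrt_prod:
  assumes "\<theta> \<in> gig_params"
  shows "((\<lambda>v. sqrt (v $ 2 * v $ 3)) has_derivative
     (\<lambda>h. (h $ 2 * \<theta> $ 3 + h $ 3 * \<theta> $ 2) / (2 * sqrt (\<theta> $ 2 * \<theta> $ 3)))) (at \<theta>)"
  using assms
  by (auto intro!: derivative_eq_intros simp: gig_params_def field_simps)

lemma has_derivative_K_mom_sqrt_prod:
  assumes "\<theta> \<in> gig_params"
  shows "((\<lambda>v. K_mom j k (v $ 1) (sqrt (v $ 2 * v $ 3))) has_derivative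
     (\<lambda>h. h $ 1 * K_mom (Suc j) k (\<theta> $ 1) (sqrt (\<theta> $ 2 * \<theta> $ 3))
        - (h $ 2 * \<theta> $ 3 + h $ 3 * \<theta> $ 2) / (2 * sqrt (\<theta> $ 2 * \<theta> $ 3))
          * K_mom j (Suc k) (\<theta> $ 1) (sqrt (\<theta> $ 2 * \<theta> $ 3)))) (at \<theta>)"
  using assms
  by (intro has_derivative_K_mom has_derivative_vec_nth_at has_derivative_sqrt_prod)
     (auto simp: gig_params_def)

lemma has_derivative_log_K:
  assumes \<theta>: "\<theta> \<in> gig_params"
  shows "((\<lambda>v. log_K (v $ 1) (v $ 2) (v $ 3)) has_derivative
    (\<lambda>h. h $ 1 * K_ratio_p \<theta> + h $ 2 * (- \<theta> $ 3 * K_ratio_z \<theta>) + h $ 3 * (- \<theta> $ 2 * K_ratio_z \<theta>)))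
    (at \<theta>)"
proof -
  have z: "0 < sqrt (\<theta> $ 2 * \<theta> $ 3)" using \<theta> by (simp add: gig_params_def)
  note K = K_mom_0_pos[OF z, of "\<theta> $ 1"]
  show ?thesis
    unfolding log_K_def bessel_K_eq_K_mom
    by (rule has_derivative_eq_rhs[OF has_derivative_ln[OF _
          has_derivative_divide'[OF has_derivative_K_mom_sqrt_prod[OF \<theta>] has_derivative_const]]])
       (use z K in \<open>simp_all add: fun_eq_iff K_ratio_p_def K_ratio_z_def divide_simps, simp add: algebra_simps\<close>)
qed

lemma
  assumes "\<theta> \<in> gig_params"
  shows partial_p_log_K: "partial_p log_K (\<theta> $ 1) (\<theta> $ 2) (\<theta> $ 3) = K_ratio_p \<theta>"
    and partial_a_log_K: "partial_a log_K (\<theta> $ 1) (\<theta> $ 2) (\<theta> $ 3) = - \<theta> $ 3 * K_ratio_z \<theta>"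
    and partial_b_log_K: "partial_b log_K (\<theta> $ 1) (\<theta> $ 2) (\<theta> $ 3) = - \<theta> $ 2 * K_ratio_z \<theta>"
  using has_derivative_log_K[OF assms] by (rule partial_p_eq partial_a_eq partial_b_eq)+

text \<open>The quotient rule applies to both ratios. The shared \<open>W\<close> encodes that the
  \<open>p\<close>-derivative commutes with those in \<open>a\<close> and \<open>b\<close>; the
  shared \<open>Wz\<close> reflects that \<open>K_ratio_z\<close> sees \<open>a\<close> and
  \<open>b\<close> only through their product.\<close>

lemma K_ratio_derivatives:
  assumes \<theta>: "\<theta> \<in> gig_params"
  obtains Mp W Wz where
    "(K_ratio_p has_derivative (\<lambda>h. h $ 1 * Mp + h $ 2 * (- \<theta> $ 3 * W) + h $ 3 * (- \<theta> $ 2 * W))) (at \<theta>)"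
    "(K_ratio_z has_derivative (\<lambda>h. h $ 1 * W + h $ 2 * (\<theta> $ 3 * Wz) + h $ 3 * (\<theta> $ 2 * Wz))) (at \<theta>)"
proof -
  define z where "z = sqrt (\<theta> $ 2 * \<theta> $ 3)"
  define K where "K j k = K_mom j k (\<theta> $ 1) z" for j k
  have z: "0 < z" using \<theta> by (simp add: gig_params_def z_def)
  have K0: "0 < K 0 0" using K_mom_0_pos[OF z] by (simp add: K_def)
  have K: "((\<lambda>v. K_mom j k (v $ 1) (sqrt (v $ 2 * v $ 3))) has_derivative
     (\<lambda>h. h $ 1 * K (Suc j) k - (h $ 2 * \<theta> $ 3 + h $ 3 * \<theta> $ 2) / (2 * z) * K j (Suc k))) (at \<theta>)" for j k
    using has_derivative_K_mom_sqrt_prod[OF \<theta>] by (simp add: K_def z_def)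
  have dz: "((\<lambda>v. 2 * sqrt (v $ 2 * v $ 3)) has_derivative (\<lambda>h. (h $ 2 * \<theta> $ 3 + h $ 3 * \<theta> $ 2) / z)) (at \<theta>)"
    by (rule has_derivative_eq_rhs[OF has_derivative_mult_right[OF has_derivative_sqrt_prod[OF \<theta>]]])
       (use z in \<open>simp add: z_def[symmetric] fun_eq_iff field_simps\<close>)
  show ?thesis
  proof
    \<comment> \<open>Under the normalised Bessel weight, \<open>Mp\<close> is the variance of
      \<open>ln t\<close>, and \<open>W\<close> is the covariance of \<open>ln t\<close> and
      \<open>(t + 1 / t) / 2\<close> divided by \<open>2 * z\<close>.\<close>
    show "(K_ratio_p has_derivative (\<lambda>h. h $ 1 * ((K 2 0 * K 0 0 - (K 1 0)\<^sup>2) / (K 0 0)\<^sup>2)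
        + h $ 2 * (- \<theta> $ 3 * ((K 1 1 * K 0 0 - K 1 0 * K 0 1) / (2 * z * (K 0 0)\<^sup>2)))
        + h $ 3 * (- \<theta> $ 2 * ((K 1 1 * K 0 0 - K 1 0 * K 0 1) / (2 * z * (K 0 0)\<^sup>2))))) (at \<theta>)"
      unfolding K_ratio_p_def[abs_def]
    proof (rule has_derivative_eq_rhs[OF has_derivative_divide'[OF K K]], unfold z_def[symmetric] K_def[symmetric])
      show "K 0 0 \<noteq> 0" using K0 by simp
    qed (use K0 z in \<open>simp add: fun_eq_iff numeral_2_eq_2[symmetric] divide_simps
        power2_eq_square, simp add: algebra_simps\<close>)
    \<comment> \<open>\<open>Wz\<close> is the derivative of \<open>K_ratio_z\<close> in the product
      \<open>a * b\<close>: the quotient rule gives \<open>2 * z ^ 2\<close> below, and the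
      derivative of the square root adds \<open>2 * z\<close>.\<close>
    show "(K_ratio_z has_derivative
       (\<lambda>h. h $ 1 * ((K 1 1 * K 0 0 - K 1 0 * K 0 1) / (2 * z * (K 0 0)\<^sup>2))
        + h $ 2 * (\<theta> $ 3 * ((z * (K 0 1)\<^sup>2 - z * K 0 2 * K 0 0 - K 0 1 * K 0 0) / (4 * z ^ 3 * (K 0 0)\<^sup>2)))
        + h $ 3 * (\<theta> $ 2 * ((z * (K 0 1)\<^sup>2 - z * K 0 2 * K 0 0 - K 0 1 * K 0 0) / (4 * z ^ 3 * (K 0 0)\<^sup>2)))))
       (at \<theta>)"
      unfolding K_ratio_z_def[abs_def]
    proof (rule has_derivative_eq_rhs[OF has_derivative_divide'[OF K has_derivative_mult[OF dz K]]],
        unfold z_def[symmetric] K_def[symmetric])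
      show "2 * z * K 0 0 \<noteq> 0" using K0 z by simp
    qed (use K0 z in \<open>simp add: fun_eq_iff numeral_2_eq_2[symmetric] divide_simps
        power2_eq_square power3_eq_cube, simp add: algebra_simps\<close>)
  qed
qed

section \<open>Jacobian of the data-free part of the score\<close>

text \<open>The summands of \<open>central_sequence\<close> without their terms in
  \<open>X i\<close>. Since the score is centred, this is minus the mean of
  \<open>(ln X, - X / 2, - 1 / (2 * X))\<close> on \<open>gig_params\<close>.\<close>

definition score_mean :: "real ^ 3 \<Rightarrow> real ^ 3" where
  "score_mean v =
     vector [ln (v $ 2 / v $ 3) / 2 - partial_p log_K (v $ 1) (v $ 2) (v $ 3),
             v $ 1 / (2 * v $ 2) - partial_a log_K (v $ 1) (v $ 2) (v $ 3),
             - v $ 1 / (2 * v $ 3) - partial_b log_K (v $ 1) (v $ 2) (v $ 3)]"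

text \<open>Symmetry of the mixed second derivatives of the log Bessel function is what makes the Jacobian
  equal to minus the (symmetric) information matrix; it shows in the shared coefficients of
  \<open>K_ratio_derivatives\<close>.\<close>
lemma has_derivative_score_mean:
  assumes \<theta>: "\<theta> \<in> gig_params"
  shows "(score_mean has_derivative (\<lambda>h. - (fisher_information \<theta> *v h))) (at \<theta>)"
proof -
  obtain Mp W Wz where
    M: "(K_ratio_p has_derivative (\<lambda>h. h $ 1 * Mp + h $ 2 * (- \<theta> $ 3 * W) + h $ 3 * (- \<theta> $ 2 * W))) (at \<theta>)" and
    W: "(K_ratio_z has_derivative (\<lambda>h. h $ 1 * W + h $ 2 * (\<theta> $ 3 * Wz) + h $ 3 * (\<theta> $ 2 * Wz))) (at \<theta>)"
    using K_ratio_derivatives[OF \<theta>] by blast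
  have pos: "0 < \<theta> $ 2" "0 < \<theta> $ 3" using \<theta> by (auto simp: gig_params_def)
  let ?w = "K_ratio_z \<theta>" and ?a = "\<theta> $ 2" and ?b = "\<theta> $ 3"
  note transform = has_derivative_transform_within_open[OF _ open_gig_params \<theta>]
  have P: "((\<lambda>v. partial_p log_K (v $ 1) (v $ 2) (v $ 3)) has_derivative
      (\<lambda>h. h $ 1 * Mp + h $ 2 * (- ?b * W) + h $ 3 * (- ?a * W))) (at \<theta>)"
    by (rule transform[OF M]) (simp add: partial_p_log_K)
  \<comment> \<open>The product rule adds \<open>- ?w\<close> in direction \<open>b\<close> here and
    in direction \<open>a\<close> for \<open>partial_b log_K\<close> below, so the two mixed
    coefficients agree.\<close>
  have "((\<lambda>v. - v $ 3 * K_ratio_z v) has_derivative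
      (\<lambda>h. h $ 1 * (- ?b * W) + h $ 2 * (- ?b * (?b * Wz)) + h $ 3 * (- ?w - ?a * ?b * Wz))) (at \<theta>)"
    by (rule derivative_eq_intros W refl)+ (simp add: fun_eq_iff algebra_simps)
  then have A: "((\<lambda>v. partial_a log_K (v $ 1) (v $ 2) (v $ 3)) has_derivative
      (\<lambda>h. h $ 1 * (- ?b * W) + h $ 2 * (- ?b * (?b * Wz)) + h $ 3 * (- ?w - ?a * ?b * Wz))) (at \<theta>)"
    by (rule transform) (simp add: partial_a_log_K)
  have "((\<lambda>v. - v $ 2 * K_ratio_z v) has_derivative
      (\<lambda>h. h $ 1 * (- ?a * W) + h $ 2 * (- ?w - ?a * ?b * Wz) + h $ 3 * (- ?a * (?a * Wz)))) (at \<theta>)"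
    by (rule derivative_eq_intros W refl)+ (simp add: fun_eq_iff algebra_simps)
  then have B: "((\<lambda>v. partial_b log_K (v $ 1) (v $ 2) (v $ 3)) has_derivative
      (\<lambda>h. h $ 1 * (- ?a * W) + h $ 2 * (- ?w - ?a * ?b * Wz) + h $ 3 * (- ?a * (?a * Wz)))) (at \<theta>)"
    by (rule transform) (simp add: partial_b_log_K)
  \<comment> \<open>Each off-diagonal entry is computed from one order of differentiation
    (\<open>P\<close> or \<open>B\<close>) but occurs in two rows; the equal coefficients in
    \<open>P\<close>, \<open>A\<close> and \<open>B\<close> let every row match.\<close>
  have \<Gamma>: "fisher_information \<theta> *v h = vector
     [h $ 1 * Mp + h $ 2 * (- 1 / (2 * ?a) - ?b * W) + h $ 3 * (1 / (2 * ?b) - ?a * W),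
      h $ 1 * (- 1 / (2 * ?a) - ?b * W) + h $ 2 * (\<theta> $ 1 / (2 * ?a\<^sup>2) - ?b * (?b * Wz)) + h $ 3 * (- ?w - ?a * ?b * Wz),
      h $ 1 * (1 / (2 * ?b) - ?a * W) + h $ 2 * (- ?w - ?a * ?b * Wz) + h $ 3 * (- \<theta> $ 1 / (2 * ?b\<^sup>2) - ?a * (?a * Wz))]"
    for h
    unfolding fisher_information_def Let_def partial_p_eq[OF P] partial_a_eq[OF P] partial_b_eq[OF P]
      partial_a_eq[OF A] partial_a_eq[OF B] partial_b_eq[OF B]
    by (simp add: vec_eq_iff forall_3 matrix_vector_mult_def sum_3 algebra_simps)
  have "((\<lambda>v. ln (v $ 2 / v $ 3) / 2) has_derivative (\<lambda>h. h $ 2 / (2 * ?a) - h $ 3 / (2 * ?b))) (at \<theta>)"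
    using pos by (auto intro!: derivative_eq_intros simp: fun_eq_iff divide_simps)
  from has_derivative_diff[OF this P]
  have "((\<lambda>v. score_mean v $ 1) has_derivative (\<lambda>h. - (fisher_information \<theta> *v h) $ 1)) (at \<theta>)"
    unfolding score_mean_def \<Gamma> vector_3
    by (rule has_derivative_eq_rhs) (simp add: fun_eq_iff algebra_simps)
  moreover
  have "((\<lambda>v. v $ 1 / (2 * v $ 2)) has_derivative (\<lambda>h. h $ 1 / (2 * ?a) - h $ 2 * (\<theta> $ 1 / (2 * ?a\<^sup>2)))) (at \<theta>)"
    using pos by (auto intro!: derivative_eq_intros simp: fun_eq_iff divide_simps power2_eq_square)
  from has_derivative_diff[OF this A]
  have "((\<lambda>v. score_mean v $ 2) has_derivative (\<lambda>h. - (fisher_information \<theta> *v h) $ 2)) (at \<theta>)"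
    unfolding score_mean_def \<Gamma> vector_3
    by (rule has_derivative_eq_rhs) (simp add: fun_eq_iff algebra_simps)
  moreover
  have "((\<lambda>v. - v $ 1 / (2 * v $ 3)) has_derivative (\<lambda>h. - h $ 1 / (2 * ?b) + h $ 3 * (\<theta> $ 1 / (2 * ?b\<^sup>2)))) (at \<theta>)"
    using pos by (auto intro!: derivative_eq_intros simp: fun_eq_iff divide_simps power2_eq_square)
  from has_derivative_diff[OF this B]
  have "((\<lambda>v. score_mean v $ 3) has_derivative (\<lambda>h. - (fisher_information \<theta> *v h) $ 3)) (at \<theta>)"
    unfolding score_mean_def \<Gamma> vector_3
    by (rule has_derivative_eq_rhs) (simp add: fun_eq_iff algebra_simps)
  ultimately have "\<forall>i. ((\<lambda>v. score_mean v $ i) has_derivative (\<lambda>h. (- (fisher_information \<theta> *v h)) $ i)) (at \<theta>)"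
    by (simp add: forall_3)
  then show ?thesis
    by (subst has_derivative_componentwise_within) (auto simp: Basis_vec_def inner_axis)
qed

section \<open>Local increments and the deterministic remainder\<close>

text \<open>The directions \<open>\<tau> n\<close> need not converge, so directional derivatives
  would not suffice; the Frechet remainder is small uniformly over bounded directions.\<close>

lemma scaled_increment_tendsto:
  fixes f :: "'a::real_normed_vector \<Rightarrow> 'b::real_normed_vector"
  assumes f: "(f has_derivative f') (at x)" and \<tau>: "bounded (range \<tau>)"
    and r: "r \<longlonglongrightarrow> (0::real)" and r0: "\<forall>\<^sub>F n in sequentially. r n \<noteq> 0"
  shows "(\<lambda>n. (f (x + r n *\<^sub>R \<tau> n) - f x) /\<^sub>R r n - f' (\<tau> n)) \<longlonglongrightarrow> 0"
proof -
  obtain B where B: "0 < B" "\<And>n. norm (\<tau> n) \<le> B"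
    using \<tau> by (auto simp: bounded_pos)
  interpret f': bounded_linear f' using f by (rule has_derivative_bounded_linear)
  show ?thesis
  proof (rule LIMSEQ_I)
    fix e :: real assume e: "0 < e"
    \<comment> \<open>The factor 2 turns the final estimate into a strict inequality.\<close>
    define c where "c = e / (2 * B)"
    have c: "0 < c" using e B by (simp add: c_def)
    obtain d where d: "0 < d"
      "\<And>y. norm (y - x) < d \<Longrightarrow> norm (f y - f x - f' (y - x)) \<le> c * norm (y - x)"
      using f c unfolding has_derivative_at_alt by blast
    have "\<forall>\<^sub>F n in sequentially. norm (r n - 0) < d / B"
      using r d(1) B(1) by (simp add: tendsto_iff dist_norm)
    from eventually_conj[OF this r0]
    obtain N where N: "\<And>n. N \<le> n \<Longrightarrow> \<bar>r n\<bar> < d / B \<and> r n \<noteq> 0"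
      by (auto simp: eventually_sequentially)
    show "\<exists>N. \<forall>n\<ge>N. norm ((f (x + r n *\<^sub>R \<tau> n) - f x) /\<^sub>R r n - f' (\<tau> n) - 0) < e"
    proof (intro exI allI impI)
      fix n assume n: "N \<le> n"
      show "norm ((f (x + r n *\<^sub>R \<tau> n) - f x) /\<^sub>R r n - f' (\<tau> n) - 0) < e"
      proof -
        have nz: "r n \<noteq> 0" using N[OF n] by simp
        have "norm (r n *\<^sub>R \<tau> n) \<le> \<bar>r n\<bar> * B"
          using B by (simp add: mult_left_mono)
        also have "\<dots> < d" using N[OF n] B by (simp add: field_simps)
        finally have "norm (f (x + r n *\<^sub>R \<tau> n) - f x - f' (r n *\<^sub>R \<tau> n)) \<le> c * norm (r n *\<^sub>R \<tau> n)"
          using d(2)[of "x + r n *\<^sub>R \<tau> n"] by simp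
        also have "\<dots> \<le> c * (\<bar>r n\<bar> * B)"
          using B c by (simp add: mult_left_mono)
        also have "\<dots> < \<bar>r n\<bar> * e"
          using e nz B by (simp add: c_def field_simps)
        finally have *: "norm (f (x + r n *\<^sub>R \<tau> n) - f x - f' (r n *\<^sub>R \<tau> n)) < \<bar>r n\<bar> * e" .
        have "(f (x + r n *\<^sub>R \<tau> n) - f x) /\<^sub>R r n - f' (\<tau> n)
          = (f (x + r n *\<^sub>R \<tau> n) - f x - f' (r n *\<^sub>R \<tau> n)) /\<^sub>R r n"
          using nz by (simp add: f'.scaleR scaleR_diff_right)
        then show ?thesis using * nz by (simp add: pos_divide_less_eq divide_inverse_commute[symmetric] mult.commute)
      qed
    qed
  qed
qed

text \<open>The identity holds sample by sample: the terms in \<open>X i\<close> cancel, and the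
  \<open>n\<close> remaining summands are equal, whence the factor \<open>real n\<close>.\<close>

lemma central_sequence_diff:
  "central_sequence n \<theta>' X - central_sequence n \<theta> X
     = (real n powr (- 1 / 2) * real n) *\<^sub>R (score_mean \<theta>' - score_mean \<theta>)"
  by (simp add: vec_eq_iff forall_3 central_sequence_def score_mean_def Let_def
      sum.distrib sum_subtractf algebra_simps)

text \<open>For a deterministic null sequence the exceedance event is eventually empty, whatever the
  laws \<open>M n\<close> are.\<close>

lemma small_o_P_const:
  fixes c :: "nat \<Rightarrow> 'b::euclidean_space"
  assumes "c \<longlonglongrightarrow> 0"
  shows "small_o_P M (\<lambda>n _. c n)"
  unfolding small_o_P_def
proof (intro conjI allI impI)
  fix \<epsilon> :: real assume "0 < \<epsilon>"
  with assms have "\<forall>\<^sub>F n in sequentially. norm (c n) < \<epsilon>"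
    by (simp add: tendsto_iff dist_norm)
  then have "\<forall>\<^sub>F n in sequentially. measure (M n) {\<omega> \<in> space (M n). \<epsilon> < norm (c n)} = 0"
    by eventually_elim simp
  then show "(\<lambda>n. measure (M n) {\<omega> \<in> space (M n). \<epsilon> < norm (c n)}) \<longlonglongrightarrow> 0"
    by (rule tendsto_eventually)
qed simp

theorem mainTheorem4:
  fixes \<theta> :: "real ^ 3" and \<theta>n \<tau> :: "nat \<Rightarrow> real ^ 3"
  assumes "\<theta> \<in> gig_params"
    and "\<And>n. 1 \<le> n \<Longrightarrow> \<theta>n n \<in> gig_params"
    and "(\<lambda>n. norm (\<theta>n n - \<theta>)) \<in> O(\<lambda>n. real n powr (- 1 / 2))"
    and "bounded (range \<tau>)"
    and "\<And>n. 1 \<le> n \<Longrightarrow> 0 < \<theta> $ 2 + real n powr (- 1 / 2) * \<tau> n $ 2"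
    and "\<And>n. 1 \<le> n \<Longrightarrow> 0 < \<theta> $ 3 + real n powr (- 1 / 2) * \<tau> n $ 3"
  shows "small_o_P (\<lambda>n. gig_law n (\<theta>n n))
           (\<lambda>n X. central_sequence n (\<theta> + (real n powr (- 1 / 2)) *\<^sub>R \<tau> n) X
                   - (central_sequence n \<theta> X - fisher_information \<theta> *v \<tau> n))"
proof -
  define r where "r n = real n powr (- 1 / 2)" for n
  have r: "r \<longlonglongrightarrow> 0"
    unfolding r_def[abs_def]
    by (rule tendsto_neg_powr[OF _ filterlim_real_sequentially]) simp
  \<comment> \<open>This turns the normalised sum into a difference quotient with step
    \<open>r n\<close>. At \<open>n = 0\<close> both sides are 0, since \<open>0 powr x = 0\<close>
    and \<open>inverse 0 = 0\<close>.\<close>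
  have inv: "r n * real n = inverse (r n)" for n
  proof (cases "n = 0")
    case False
    then have "r n * (r n * real n) = 1"
      unfolding r_def mult.assoc[symmetric] powr_add[symmetric]
      by (simp add: powr_minus_divide)
    then show ?thesis by (metis inverse_unique)
  qed (simp add: r_def)
  \<comment> \<open>The derivative of \<open>score_mean\<close> is minus the information matrix, so
    subtracting it from the difference quotient produces the plus sign.\<close>
  let ?c = "\<lambda>n. (r n * real n) *\<^sub>R (score_mean (\<theta> + r n *\<^sub>R \<tau> n) - score_mean \<theta>) + fisher_information \<theta> *v \<tau> n"
  have "\<forall>\<^sub>F n in sequentially. r n \<noteq> 0"
    using eventually_gt_at_top[of 0] by eventually_elim (simp add: r_def)
  from scaled_increment_tendsto[OF has_derivative_score_mean[OF assms(1)] assms(4) r this]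
  have "?c \<longlonglongrightarrow> 0"
    by (simp add: inv)
  then have "small_o_P (\<lambda>n. gig_law n (\<theta>n n)) (\<lambda>n _. ?c n)"
    by (rule small_o_P_const)
  moreover have "central_sequence n (\<theta> + r n *\<^sub>R \<tau> n) X - (central_sequence n \<theta> X - fisher_information \<theta> *v \<tau> n) = ?c n"
    for n X
    using central_sequence_diff[of n "\<theta> + r n *\<^sub>R \<tau> n" X \<theta>]
    by (simp add: r_def algebra_simps)
  ultimately have "small_o_P (\<lambda>n. gig_law n (\<theta>n n)) (\<lambda>n X. central_sequence n (\<theta> + r n *\<^sub>R \<tau> n) X
      - (central_sequence n \<theta> X - fisher_information \<theta> *v \<tau> n))"
    by (simp only:)
  then show ?thesis
    by (simp only: r_def)
qed

end
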